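(* Let $ABC$ be a triangle in the Euclidean plane with circumcircle $\Sigma$ and orthocentre $H$, and let $J$ be a point of $\Sigma$ distinct from $A,B,C$. Let $Q$ be any point on the perpendicular bisector of $JH$, and let $S$ be the circle with centre $Q$ passing through $J$ and $H$. Let $X, Y, Z$ be the second intersections (other than $H$) with $S$ of the altitudes of $ABC$ through $A$, $B$, $C$ respectively. Assume that each of the triples $A,J,X$; $B,J,Y$; $C,J,Z$ consists of three distinct non-collinear points, so that the circles $AJX$, $BJY$, $CJZ$ are defined. Let $L$ be the second intersection (other than $J$) of circles $BJY$ and $CJZ$, let $M$ be the second intersection of circles $CJZ$ and $AJX$, and let $N$ be the second intersection of circles $AJX$ and $BJY$. Then $L, M, N$ are collinear.
   Context: The altitude through $A$ is the line through $A$ perpendicular to $BC$, and similarly for $B$ and $C$. Each altitude passes through $H$, which lies on $S$; if an altitude is tangent to $S$ at $H$, the corresponding second intersection is taken to be $H$ itself. Similarly, if two of the circles $AJX$, $BJY$, $CJZ$ were tangent at $J$, their second intersection would be taken to be $J$. *)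

theory Defs
  imports "HOL-Analysis.Analysis"
begin

type_synonym point = "real^2"

text \<open>The circle through three points is a relation between point sets and points; for
  non-collinear points exactly one \<open>C\<close> satisfies it (the circumcircle of \<open>P Q R\<close>).\<close>

definition circle_through :: "point set \<Rightarrow> point \<Rightarrow> point \<Rightarrow> point \<Rightarrow> bool" where
  "circle_through C P Q R \<longleftrightarrow>
     (\<exists>c r. r > 0 \<and> C = sphere c r) \<and> P \<in> C \<and> Q \<in> C \<and> R \<in> C"

text \<open>The line through the first argument perpendicular to the line joining the other two.\<close>

definition altitude :: "point \<Rightarrow> point \<Rightarrow> point \<Rightarrow> point set" where
  "altitude P Q R = {x. (x - P) \<bullet> (R - Q) = 0}"

definition orthocentre :: "point \<Rightarrow> point \<Rightarrow> point \<Rightarrow> point \<Rightarrow> bool" where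
  "orthocentre H A B C \<longleftrightarrow>
     H \<in> altitude A B C \<and> H \<in> altitude B C A \<and> H \<in> altitude C A B"

definition perp_bisector :: "point \<Rightarrow> point \<Rightarrow> point set" where
  "perp_bisector P Q = {x. (x - midpoint P Q) \<bullet> (Q - P) = 0}"

text \<open>\<open>X\<close> is the second intersection, besides \<open>P\<close>, of two curves (a line and a circle, or two
  circles). In the tangent case the intersection is \<open>{P}\<close>, and the condition forces \<open>X = P\<close>;
  otherwise \<open>X\<close> is the intersection point different from \<open>P\<close>.\<close>

definition second_intersection :: "point set \<Rightarrow> point set \<Rightarrow> point \<Rightarrow> point \<Rightarrow> bool" where
  "second_intersection U V P X \<longleftrightarrow> U \<inter> V = {P, X}"

end

theory Submission
  imports Defs
begin

text \<open>
  Identify the plane with \<open>\<complex>\<close> and write \<open>h\<close>, \<open>j\<close>, \<open>q\<close>, \<open>a\<close>, \<open>b\<close>, \<open>c\<close> for the points. The idea is that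
  a single spiral similarity \<open>T\<close> explains the whole figure: let \<open>T z = j + k * (z - j)\<close> be the one
  that fixes \<open>j\<close> and sends \<open>h\<close> to \<open>q\<close>. As \<open>q\<close> is equidistant from \<open>j\<close> and \<open>h\<close>, \<open>Re k = 1/2\<close>, that
  is \<open>cnj k = 1 - k\<close>; so \<open>T z\<close> is equidistant from \<open>j\<close> and \<open>z\<close> for every \<open>z\<close>.

  Let \<open>j'\<close> be the reflection of \<open>j\<close> in the altitude through \<open>a\<close>. The circles through \<open>j\<close> centred at
  \<open>h\<close> and at \<open>a\<close> both contain \<open>j'\<close>. The first is mapped by \<open>T\<close> to the circle \<open>S\<close>, and one computes
  that \<open>T j'\<close> is the second point of \<open>S\<close> on the altitude (\<open>mirror_orthocentre\<close>): thus \<open>T j' = x\<close>.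
  The image of the second circle is centred at \<open>T a\<close> and passes through \<open>j\<close>, \<open>x\<close> and, by the remark
  on \<open>Re k\<close>, through \<open>a\<close>. So it is the circle \<open>AJX\<close>, whose centre is therefore \<open>T a\<close>
  (\<open>centre_of_vertex_circle\<close>); likewise for the other two circles.

  Two circles that meet at \<open>j\<close> meet again at the reflection of \<open>j\<close> in the line of centres. Hence
  \<open>L\<close>, \<open>M\<close>, \<open>N\<close> are the images under \<open>T\<close> of the reflections of \<open>j\<close> in the sides of the triangle.
  Since \<open>j\<close> is on the circumcircle, these reflections lie on one line, the Steiner line of \<open>j\<close>
  (\<open>steiner_line\<close>), and \<open>T\<close> preserves collinearity.

  The similarity \<open>T\<close> requires \<open>h \<noteq> j\<close>: an orthocentre on the circumcircle is a vertex
  (\<open>orthocentre_not_on_circle\<close>).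
\<close>

section \<open>Lines, circles and reflections in the complex plane\<close>

text \<open>The reflection of \<open>z\<close> in the line through \<open>c\<close> with direction \<open>d\<close>.\<close>

definition mirror :: "complex \<Rightarrow> complex \<Rightarrow> complex \<Rightarrow> complex" where
  "mirror c d z = c + d / cnj d * cnj (z - c)"

lemma orthogonal_iff_cnj:
  "v \<bullet> w = 0 \<longleftrightarrow> v * cnj w + cnj v * w = 0" for v w :: complex
proof -
  have "v * cnj w + cnj v * w = complex_of_real (2 * (v \<bullet> w))"
    by (simp add: complex_eq_iff inner_complex_def)
  then show ?thesis by (simp only: of_real_eq_0_iff) simp
qed

lemma dist_eq_iff_cnj:
  "dist c x = dist c y \<longleftrightarrow> (x - c) * cnj (x - c) = (y - c) * cnj (y - c)" for c x y :: complex
proof -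
  have "dist c x = dist c y \<longleftrightarrow> (cmod (x - c))\<^sup>2 = (cmod (y - c))\<^sup>2"
    by (simp add: dist_norm norm_minus_commute)
  also have "\<dots> \<longleftrightarrow> complex_of_real ((cmod (x - c))\<^sup>2) = complex_of_real ((cmod (y - c))\<^sup>2)"
    by (simp only: of_real_eq_iff)
  also have "\<dots> \<longleftrightarrow> (x - c) * cnj (x - c) = (y - c) * cnj (y - c)"
    by (simp only: complex_norm_square)
  finally show ?thesis .
qed

text \<open>The form of the hypothesis covers both kinds of second intersection: a circle with a line
  orthogonal to \<open>d\<close>, and two circles whose line of centres has direction \<open>d\<close> (whose common points
  are those of one circle on the radical axis). In both cases the configuration is symmetric about
  the diameter of direction \<open>d\<close>, and a line meets a circle at most twice. In the tangent case \<open>p\<close>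
  is on the axis and is its own reflection.\<close>

lemma second_point_is_mirror:
  fixes c d p x :: complex
  assumes "d \<noteq> 0" and pts: "{w. (w - p) \<bullet> d = 0 \<and> dist c w = dist c p} = {p, x}"
  shows "x = mirror c d p"
proof -
  have nz: "cnj d \<noteq> 0" using assms by simp
  have "w = p \<or> w = mirror c d p" if perp: "(w - p) \<bullet> d = 0" and eq: "dist c w = dist c p" for w
  proof -
    have 1: "(w - p) * cnj d + cnj (w - p) * d = 0"
      using perp by (simp only: orthogonal_iff_cnj)
    have 2: "(w - c) * cnj (w - c) = (p - c) * cnj (p - c)"
      using eq by (simp only: dist_eq_iff_cnj)
    \<comment> \<open>Eliminating the conjugate of \<open>w\<close> leaves a quadratic equation with these two roots.\<close>
    have "(w - p) * ((w - c) * cnj d - d * cnj (p - c)) = 0"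
      using 1 2 unfolding complex_cnj_diff by algebra
    moreover have "w = mirror c d p" if "(w - c) * cnj d - d * cnj (p - c) = 0"
      using that nz by (simp add: mirror_def field_simps)
    ultimately show ?thesis by auto
  qed
  moreover have "(mirror c d p - p) \<bullet> d = 0"
    using assms(1) by (simp add: orthogonal_iff_cnj mirror_def field_simps)
  moreover have "dist c (mirror c d p) = dist c p"
    using assms(1) by (simp add: dist_eq_iff_cnj mirror_def field_simps)
  ultimately have "{p, x} = {p, mirror c d p}"
    using pts by blast
  then show ?thesis by (auto simp: doubleton_eq_iff)
qed

lemma mirror_similarity:
  assumes "k \<noteq> 0"
  shows "mirror (j + k * (c - j)) (k * d) j = j + k * (mirror c d j - j)"
  using assms by (simp add: mirror_def algebra_simps)

text \<open>Subtracting the equations of the circles shows that their common points are the points of one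
  of them on the line through \<open>j\<close> orthogonal to the line of centres.\<close>

lemma second_common_point_of_circles:
  fixes p p' j l :: complex
  assumes "p \<noteq> p'" and "sphere p s \<inter> sphere p' s' = {j, l}"
  shows "l = mirror p (p' - p) j"
proof (rule second_point_is_mirror)
  show "p' - p \<noteq> 0" using assms by simp
  have j: "dist p j = s" "dist p' j = s'" using assms(2) by auto
  have *: "dist p' w = dist p' j \<longleftrightarrow> (w - j) \<bullet> (p' - p) = 0" if "dist p w = dist p j" for w
    using that unfolding dist_eq_iff_cnj orthogonal_iff_cnj
    by (simp add: algebra_simps) algebra
  show "{w. (w - j) \<bullet> (p' - p) = 0 \<and> dist p w = dist p j} = {j, l}"
    unfolding assms(2)[symmetric] using j * by auto
qed

lemma collinear_iff_cnj:
  "collinear {x, y, z} \<longleftrightarrow> (x - y) * cnj (z - y) = cnj (x - y) * (z - y)" for x y z :: complex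
proof -
  have "collinear {x, y, z} \<longleftrightarrow> (z - y) / (x - y) \<in> \<real>"
    unfolding collinear_iff_Reals[symmetric] by (rule collinear_3) simp
  also have "\<dots> \<longleftrightarrow> cnj ((z - y) / (x - y)) = (z - y) / (x - y)"
    by (simp only: Reals_cnj_iff)
  also have "\<dots> \<longleftrightarrow> (x - y) * cnj (z - y) = cnj (x - y) * (z - y)"
    by (cases "x = y") (auto simp: frac_eq_eq mult.commute simp del: complex_cnj_diff simp: complex_cnj_divide)
  finally show ?thesis .
qed

text \<open>Two centres would both lie on the perpendicular bisectors of \<open>u v\<close> and of \<open>w v\<close>, so that \<open>p' - p\<close>
  would be orthogonal to both chords and the chords would be parallel.\<close>

lemma unique_centre:
  fixes p p' u v w :: complex
  assumes "\<not> collinear {u, v, w}"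
    and "dist p u = dist p v" "dist p w = dist p v"
    and "dist p' u = dist p' v" "dist p' w = dist p' v"
  shows "p' = p"
proof (rule ccontr)
  assume ne: "p' \<noteq> p"
  have perp: "(y - v) * cnj (p' - p) + cnj (y - v) * (p' - p) = 0"
    if "dist p y = dist p v" "dist p' y = dist p' v" for y
    using that unfolding dist_eq_iff_cnj complex_cnj_diff by algebra
  have "(p' - p) * ((u - v) * cnj (w - v) - cnj (u - v) * (w - v)) = 0"
    using perp[OF assms(2,4)] perp[OF assms(3,5)] by algebra
  then show False using ne assms(1) by (simp add: collinear_iff_cnj)
qed

text \<open>If \<open>h\<close> lies on the line through \<open>a\<close> orthogonal to \<open>u\<close>, then the similarity with centre \<open>j\<close>, factor
  \<open>k\<close>, sends the reflection of \<open>j\<close> in this line to the second point where the line meets the circle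
  centred at \<open>q\<close> through \<open>h\<close>. With \<open>v = h - j\<close> and \<open>e = u / cnj u\<close>, both sides are
  \<open>j + k * (v + e * cnj v)\<close>, because the conjugate of \<open>1 - k\<close> is \<open>k\<close>.\<close>

lemma mirror_orthocentre:
  fixes a h j q u :: complex
  assumes "Re k = 1/2"
    and "(h - a) \<bullet> u = 0" and "u \<noteq> 0"
    and "q = j + k * (h - j)"
  shows "mirror q u h = j + k * (mirror a (\<i> * u) j - j)"
proof -
  have k: "cnj k = 1 - k" using assms(1) by (simp add: complex_eq_iff)
  have 1: "(h - a) * cnj u + cnj (h - a) * u = 0"
    using assms(2) by (simp only: orthogonal_iff_cnj)
  then have 2: "u / cnj u * cnj h = a + u / cnj u * cnj a - h"
    using assms(3) by (simp add: field_simps)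
  define e where "e = u / cnj u"
  have e: "\<i> * u / cnj (\<i> * u) = - e" by (simp add: e_def field_simps)
  show ?thesis
    using 2 unfolding mirror_def e e_def[symmetric] assms(4)
    by (simp add: k) algebra
qed

section \<open>The Steiner line and the orthocentre\<close>

text \<open>On a circle of squared radius \<open>r\<close> about \<open>0\<close> conjugation is \<open>z \<mapsto> r / z\<close>, which makes the
  reflection in a chord a rational expression: \<open>b + c - b * c / j\<close>.\<close>

lemma mirror_point_on_circle:
  fixes b c j e :: complex
  assumes "dist e b = dist e c" "dist e c = dist e j" "b \<noteq> c"
  shows "mirror b (c - b) j - e = (b - e) + (c - e) - (b - e) * (c - e) / (j - e)"
proof -
  define b1 c1 j1 where "b1 = b - e" "c1 = c - e" "j1 = j - e"
  note d = this
  have 1: "b1 * cnj b1 = c1 * cnj c1" and 2: "c1 * cnj c1 = j1 * cnj j1"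
    using assms(1,2) unfolding dist_eq_iff_cnj d by auto
  have ne: "b1 \<noteq> c1" using assms(3) by (simp add: d)
  then have nz: "b1 \<noteq> 0" "c1 \<noteq> 0" "j1 \<noteq> 0" using 1 2 by auto
  define r where "r = j1 * cnj j1"
  have r: "r \<noteq> 0" using nz by (simp add: r_def)
  have cj: "cnj b1 = r / b1" "cnj c1 = r / c1" "cnj j1 = r / j1"
    using 1 2 nz by (simp_all add: r_def field_simps)
  have "mirror b (c - b) j - e = b1 + (c1 - b1) / (r / c1 - r / b1) * (r / j1 - r / b1)"
  proof -
    have "cnj (c - b) = r / c1 - r / b1" "cnj (j - b) = r / j1 - r / b1"
      unfolding cj[symmetric] by (simp_all add: d)
    then show ?thesis by (simp only: mirror_def) (simp add: d)
  qed
  also have "(c1 - b1) / (r / c1 - r / b1) = - b1 * c1 / r"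
    using nz r ne by (simp add: divide_simps) (simp add: algebra_simps)
  also have "b1 + - b1 * c1 / r * (r / j1 - r / b1) = b1 + c1 - b1 * c1 / j1"
    using nz r by (simp add: field_simps)
  finally show ?thesis by (simp add: d)
qed

text \<open>With the centre at \<open>0\<close>, the differences of the three reflections are products such as
  \<open>(b - a) * (j - c) / j\<close>. Conjugation multiplies each of them by the same factor \<open>r * j / (a * b * c)\<close>,
  where \<open>r\<close> is the squared radius, which is symmetric in the vertices; so they are parallel.\<close>

lemma steiner_line:
  fixes a b c j e :: complex
  assumes "dist e a = dist e j" "dist e b = dist e j" "dist e c = dist e j"
    and "a \<noteq> b" "b \<noteq> c" "c \<noteq> a"
  shows "collinear {mirror b (c - b) j, mirror c (a - c) j, mirror a (b - a) j}"
proof -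
  define a1 b1 c1 j1 where "a1 = a - e" "b1 = b - e" "c1 = c - e" "j1 = j - e"
  note d = this
  have 1: "a1 * cnj a1 = j1 * cnj j1" "b1 * cnj b1 = j1 * cnj j1" "c1 * cnj c1 = j1 * cnj j1"
    using assms(1-3) unfolding dist_eq_iff_cnj d by auto
  have nz: "a1 \<noteq> 0" "b1 \<noteq> 0" "c1 \<noteq> 0" "j1 \<noteq> 0"
    using 1 assms(4,5) by (auto simp: d)
  define r where "r = j1 * cnj j1"
  have r: "r \<noteq> 0" using nz by (simp add: r_def)
  have cj: "cnj a1 = r / a1" "cnj b1 = r / b1" "cnj c1 = r / c1" "cnj j1 = r / j1"
    using 1 nz by (simp_all add: r_def field_simps)
  have L: "mirror b (c - b) j = e + b1 + c1 - b1 * c1 / j1"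
    using mirror_point_on_circle[of e b c j] assms by (simp add: d algebra_simps)
  have M: "mirror c (a - c) j = e + c1 + a1 - c1 * a1 / j1"
    using mirror_point_on_circle[of e c a j] assms by (simp add: d algebra_simps)
  have N: "mirror a (b - a) j = e + a1 + b1 - a1 * b1 / j1"
    using mirror_point_on_circle[of e a b j] assms by (simp add: d algebra_simps)
  have LM: "mirror b (c - b) j - mirror c (a - c) j = (b1 - a1) * (j1 - c1) / j1"
    unfolding L M using nz by (simp add: field_simps)
  have NM: "mirror a (b - a) j - mirror c (a - c) j = (b1 - c1) * (j1 - a1) / j1"
    unfolding N M using nz by (simp add: field_simps)
  have "cnj ((u - v) * (j1 - w) / j1) = r * j1 / (u * v * w) * ((u - v) * (j1 - w) / j1)"
    if "cnj u = r / u" "cnj v = r / v" "cnj w = r / w" "u \<noteq> 0" "v \<noteq> 0" "w \<noteq> 0" for u v w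
  proof -
    have "cnj ((u - v) * (j1 - w) / j1) = (r / u - r / v) * (r / j1 - r / w) / (r / j1)"
      by (simp add: that cj)
    also have "r / u - r / v = r * (v - u) / (u * v)" using that by (simp add: field_simps)
    also have "r / j1 - r / w = r * (w - j1) / (j1 * w)" using that nz by (simp add: field_simps)
    also have "r * (v - u) / (u * v) * (r * (w - j1) / (j1 * w)) / (r / j1)
        = r * j1 / (u * v * w) * ((u - v) * (j1 - w) / j1)"
      using that nz r by (simp add: divide_simps) (simp add: algebra_simps)
    finally show ?thesis .
  qed
  from this[of b1 a1 c1] this[of b1 c1 a1]
  have "cnj ((b1 - a1) * (j1 - c1) / j1) = r * j1 / (a1 * b1 * c1) * ((b1 - a1) * (j1 - c1) / j1)"
    "cnj ((b1 - c1) * (j1 - a1) / j1) = r * j1 / (a1 * b1 * c1) * ((b1 - c1) * (j1 - a1) / j1)"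
    using cj nz by (simp_all only: mult_ac not_False_eq_True)
  then show ?thesis
    unfolding collinear_iff_cnj LM NM by (simp only: mult_ac)
qed

text \<open>The chords \<open>x j\<close> and \<open>y z\<close> of a circle about \<open>0\<close> have the directions of square roots of \<open>- x * j\<close>
  and of \<open>- y * z\<close>, so orthogonality means that these products are opposite.\<close>

lemma chord_perpendicular_to_chord:
  fixes e j x y z :: complex
  assumes "dist e x = dist e j" "dist e y = dist e j" "dist e z = dist e j"
    and "x \<noteq> j" "y \<noteq> z" "(j - x) \<bullet> (z - y) = 0"
  shows "(x - e) * (j - e) = - ((y - e) * (z - e))"
proof -
  define x1 y1 z1 j1 where "x1 = x - e" "y1 = y - e" "z1 = z - e" "j1 = j - e"
  note d = this
  have 1: "x1 * cnj x1 = j1 * cnj j1" "y1 * cnj y1 = j1 * cnj j1" "z1 * cnj z1 = j1 * cnj j1"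
    using assms(1-3) unfolding dist_eq_iff_cnj d by auto
  have nz: "x1 \<noteq> 0" "y1 \<noteq> 0" "z1 \<noteq> 0" "j1 \<noteq> 0"
    using 1 assms(4,5) by (auto simp: d)
  define r where "r = j1 * cnj j1"
  have r: "r \<noteq> 0" using nz by (simp add: r_def)
  have cj: "cnj x1 = r / x1" "cnj y1 = r / y1" "cnj z1 = r / z1" "cnj j1 = r / j1"
    using 1 nz by (simp_all add: r_def field_simps)
  have "(j1 - x1) * cnj (z1 - y1) + cnj (j1 - x1) * (z1 - y1) = 0"
    using assms(6) unfolding orthogonal_iff_cnj by (simp add: d)
  then have "(j1 - x1) * (r / z1 - r / y1) + (r / j1 - r / x1) * (z1 - y1) = 0"
    by (simp add: cj)
  moreover have "(j1 - x1) * (r / z1 - r / y1) + (r / j1 - r / x1) * (z1 - y1)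
      = r * (j1 - x1) * (y1 - z1) * (x1 * j1 + y1 * z1) / (x1 * y1 * z1 * j1)"
    using nz by (simp add: field_simps)
  ultimately have "(j1 - x1) * (y1 - z1) * (x1 * j1 + y1 * z1) = 0" using r nz by simp
  then have "x1 * j1 + y1 * z1 = 0" using assms(4,5) by (simp add: d)
  then show ?thesis by (simp add: d eq_neg_iff_add_eq_0)
qed

text \<open>If \<open>j\<close> were on the three altitudes, then with the centre at \<open>0\<close> the products \<open>a * j\<close>, \<open>b * j\<close>, \<open>c * j\<close>
  would be \<open>- b * c\<close>, \<open>- c * a\<close>, \<open>- a * b\<close>. Then \<open>a\<close>, \<open>b\<close>, \<open>c\<close> have the same square, which is impossible for
  three distinct numbers.\<close>

lemma orthocentre_not_on_circle:
  fixes a b c j e :: complex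
  assumes "dist e a = dist e j" "dist e b = dist e j" "dist e c = dist e j"
    and "a \<noteq> b" "b \<noteq> c" "c \<noteq> a" "j \<noteq> a" "j \<noteq> b" "j \<noteq> c"
  shows "\<not> ((j - a) \<bullet> (c - b) = 0 \<and> (j - b) \<bullet> (a - c) = 0 \<and> (j - c) \<bullet> (b - a) = 0)"
proof
  assume perp: "(j - a) \<bullet> (c - b) = 0 \<and> (j - b) \<bullet> (a - c) = 0 \<and> (j - c) \<bullet> (b - a) = 0"
  define a1 b1 c1 j1 where "a1 = a - e" "b1 = b - e" "c1 = c - e" "j1 = j - e"
  note d = this
  have A: "a1 * j1 = - (b1 * c1)" and B: "b1 * j1 = - (c1 * a1)" and C: "c1 * j1 = - (a1 * b1)"
    using chord_perpendicular_to_chord[of e a j b c] chord_perpendicular_to_chord[of e b j c a]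
      chord_perpendicular_to_chord[of e c j a b] perp assms unfolding d by auto
  have ne: "a1 \<noteq> b1" "b1 \<noteq> c1" "c1 \<noteq> a1" using assms by (auto simp: d)
  have "j1 \<noteq> 0" using assms by (auto simp: d)
  moreover have "j1 * (a1\<^sup>2 - b1\<^sup>2) = 0" "j1 * (b1\<^sup>2 - c1\<^sup>2) = 0" "j1 * (c1\<^sup>2 - a1\<^sup>2) = 0"
    using A B C by algebra+
  ultimately have "a1 = - b1" "b1 = - c1" "c1 = - a1"
    using ne by (auto simp: power2_eq_iff)
  then show False using ne by auto
qed

section \<open>The configuration in the complex plane\<close>

text \<open>By \<open>mirror_orthocentre\<close>, \<open>x\<close> is the image of the reflection of \<open>j\<close> in the altitude through \<open>a\<close>,
  whose direction is \<open>\<i> * u\<close>. The image of \<open>a\<close> under the similarity is equidistant from \<open>j\<close> and \<open>a\<close> since \<open>Re k = 1/2\<close>, and from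
  \<open>j\<close> and \<open>x\<close> since \<open>a\<close> is equidistant from \<open>j\<close> and its reflection in a line through \<open>a\<close>.\<close>

lemma centre_of_vertex_circle:
  fixes a h j k q u x p :: complex
  assumes k: "Re k = 1/2"
    and q: "q = j + k * (h - j)"
    and "u \<noteq> 0" and foot: "(h - a) \<bullet> u = 0"
    and S: "{w. (w - a) \<bullet> u = 0} \<inter> sphere q r = {h, x}"
    and "\<not> collinear {a, j, x}"
    and on: "a \<in> sphere p s" "j \<in> sphere p s" "x \<in> sphere p s"
  shows "p = j + k * (a - j)"
proof (rule unique_centre[OF assms(6), symmetric])
  have "dist q h = r" using S by auto
  moreover have "(w - a) \<bullet> u = 0 \<longleftrightarrow> (w - h) \<bullet> u = 0" for w
    using foot by (simp add: inner_diff_left)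
  ultimately have "{w. (w - h) \<bullet> u = 0 \<and> dist q w = dist q h} = {h, x}"
    using S by auto
  from second_point_is_mirror[OF \<open>u \<noteq> 0\<close> this]
  have x: "x = j + k * (mirror a (\<i> * u) j - j)"
    using mirror_orthocentre[OF k foot \<open>u \<noteq> 0\<close> q] by simp
  have iso: "cmod (mirror a (\<i> * u) j - a) = cmod (j - a)"
    using \<open>u \<noteq> 0\<close> by (simp add: mirror_def norm_mult norm_divide flip: complex_cnj_diff)
  have "1 - k = cnj k" using k by (simp add: complex_eq_iff)
  then have "cmod (1 - k) = cmod k" by simp
  moreover have "(j + k * (a - j)) - a = (1 - k) * (j - a)"
    by (simp add: algebra_simps)
  moreover have "(j + k * (a - j)) - j = k * (a - j)" by simp
  ultimately show "dist (j + k * (a - j)) a = dist (j + k * (a - j)) j"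
    by (simp only: dist_norm norm_mult norm_minus_commute)
  have "(j + k * (a - j)) - x = k * (a - mirror a (\<i> * u) j)"
    by (simp add: x algebra_simps)
  then have "dist (j + k * (a - j)) x = cmod k * cmod (mirror a (\<i> * u) j - a)"
    by (simp only: dist_norm norm_mult norm_minus_commute)
  also have "\<dots> = cmod k * cmod (j - a)" by (simp only: iso)
  also have "\<dots> = dist (j + k * (a - j)) j"
    by (simp add: dist_norm norm_mult norm_minus_commute)
  finally show "dist (j + k * (a - j)) x = dist (j + k * (a - j)) j" .
  show "dist p a = dist p j" "dist p x = dist p j"
    using on by auto
qed

lemma second_common_point_of_scaled_circles:
  fixes b c j k l :: complex
  assumes "k \<noteq> 0" "b \<noteq> c"
    and "sphere (j + k * (b - j)) s \<inter> sphere (j + k * (c - j)) s' = {j, l}"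
  shows "l = j + k * (mirror b (c - b) j - j)"
proof -
  have "l = mirror (j + k * (b - j)) (j + k * (c - j) - (j + k * (b - j))) j"
    using assms by (intro second_common_point_of_circles) auto
  also have "j + k * (c - j) - (j + k * (b - j)) = k * (c - b)"
    by (simp add: algebra_simps)
  finally show ?thesis using mirror_similarity[OF assms(1)] by simp
qed

lemma collinear_similarity:
  fixes j k x y z :: complex
  assumes "collinear {x, y, z}"
  shows "collinear {j + k * (x - j), j + k * (y - j), j + k * (z - j)}"
proof -
  have "(k * (x - y)) * cnj (k * (z - y)) = cnj (k * (x - y)) * (k * (z - y))"
    using assms unfolding collinear_iff_cnj complex_cnj_mult by algebra
  then show ?thesis unfolding collinear_iff_cnj by (simp add: algebra_simps)
qed

text \<open>All three centres are found with the same factor \<open>k\<close>, so they form a triangle directly similar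
  to \<open>a b c\<close> with \<open>j\<close> as the centre of similarity. This reduces the claim to the Steiner line of \<open>j\<close>.\<close>

theorem collinear_second_intersections_complex:
  fixes a b c h j q x y z l m n e :: complex
  assumes circ: "dist e a = dist e j" "dist e b = dist e j" "dist e c = dist e j"
    and ne: "a \<noteq> b" "b \<noteq> c" "c \<noteq> a" "j \<noteq> a" "j \<noteq> b" "j \<noteq> c"
    and alt: "(h - a) \<bullet> (c - b) = 0" "(h - b) \<bullet> (a - c) = 0" "(h - c) \<bullet> (b - a) = 0"
    and q: "dist q j = dist q h"
    and S: "{w. (w - a) \<bullet> (c - b) = 0} \<inter> sphere q r = {h, x}"
      "{w. (w - b) \<bullet> (a - c) = 0} \<inter> sphere q r = {h, y}"
      "{w. (w - c) \<bullet> (b - a) = 0} \<inter> sphere q r = {h, z}"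
    and nc: "\<not> collinear {a, j, x}" "\<not> collinear {b, j, y}" "\<not> collinear {c, j, z}"
    and A: "a \<in> sphere pa ra" "j \<in> sphere pa ra" "x \<in> sphere pa ra"
    and B: "b \<in> sphere pb rb" "j \<in> sphere pb rb" "y \<in> sphere pb rb"
    and C: "c \<in> sphere pc rc" "j \<in> sphere pc rc" "z \<in> sphere pc rc"
    and L: "sphere pb rb \<inter> sphere pc rc = {j, l}"
    and M: "sphere pc rc \<inter> sphere pa ra = {j, m}"
    and N: "sphere pa ra \<inter> sphere pb rb = {j, n}"
  shows "collinear {l, m, n}"
proof -
  have hj: "h \<noteq> j" using orthocentre_not_on_circle[OF circ ne] alt by auto
  define k where "k = (q - j) / (h - j)"
  have qk: "q = j + k * (h - j)" using hj by (simp add: k_def)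
  have "cmod (k * (h - j)) = cmod ((k - 1) * (h - j))"
    using q by (simp add: dist_norm qk algebra_simps)
  then have "cmod k = cmod (k - 1)" using hj by (simp add: norm_mult)
  then have "(cmod k)\<^sup>2 = (cmod (k - 1))\<^sup>2" by simp
  then have k: "Re k = 1/2"
    unfolding cmod_power2 by (simp add: power2_eq_square algebra_simps)
  then have k0: "k \<noteq> 0" by auto
  have pa: "pa = j + k * (a - j)"
    by (rule centre_of_vertex_circle[OF k qk _ alt(1) S(1) nc(1) A]) (use ne in simp)
  have pb: "pb = j + k * (b - j)"
    by (rule centre_of_vertex_circle[OF k qk _ alt(2) S(2) nc(2) B]) (use ne in simp)
  have pc: "pc = j + k * (c - j)"
    by (rule centre_of_vertex_circle[OF k qk _ alt(3) S(3) nc(3) C]) (use ne in simp)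
  have "l = j + k * (mirror b (c - b) j - j)"
    by (rule second_common_point_of_scaled_circles[OF k0 ne(2) L[unfolded pb pc]])
  moreover have "m = j + k * (mirror c (a - c) j - j)"
    by (rule second_common_point_of_scaled_circles[OF k0 ne(3) M[unfolded pa pc]])
  moreover have "n = j + k * (mirror a (b - a) j - j)"
    by (rule second_common_point_of_scaled_circles[OF k0 ne(1) N[unfolded pa pb]])
  ultimately show ?thesis
    using collinear_similarity[OF steiner_line[OF circ ne(1-3)]] by simp
qed

section \<open>Transfer to the Euclidean plane\<close>

definition to_complex :: "real^2 \<Rightarrow> complex" where
  "to_complex v = Complex (v $ 1) (v $ 2)"

lemma linear_to_complex: "linear to_complex"
  by (rule linearI) (simp_all add: to_complex_def complex_eq_iff)

lemma inner_to_complex: "to_complex v \<bullet> to_complex w = v \<bullet> w"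
  by (simp add: to_complex_def inner_complex_def inner_vec_def sum_2)

lemma bij_to_complex: "bij to_complex"
proof (rule bijI)
  show "inj to_complex"
    by (rule injI) (simp add: to_complex_def vec_eq_iff forall_2)
  have "to_complex (vector [Re z, Im z]) = z" for z
    by (simp add: to_complex_def)
  then show "surj to_complex" by (rule surjI)
qed

lemma dist_to_complex: "dist (to_complex v) (to_complex w) = dist v w"
  by (simp add: dist_norm norm_eq_sqrt_inner inner_to_complex flip: linear_diff[OF linear_to_complex])

lemma image_sphere_to_complex: "to_complex ` sphere c r = sphere (to_complex c) r"
proof -
  have "sphere (to_complex c) r = {to_complex x |x. dist c x = r}"
    using bij_is_surj[OF bij_to_complex] unfolding sphere_def
    by (auto simp: dist_to_complex) (metis dist_to_complex surjD)
  then show ?thesis by (auto simp: sphere_def)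
qed

lemma image_altitude_to_complex:
  "to_complex ` altitude P Q R
    = {w. (w - to_complex P) \<bullet> (to_complex R - to_complex Q) = 0}" (is "?l = ?r")
proof
  have *: "(to_complex w - to_complex P) \<bullet> (to_complex R - to_complex Q) = (w - P) \<bullet> (R - Q)" for w
    by (simp add: inner_to_complex flip: linear_diff[OF linear_to_complex])
  show "?l \<subseteq> ?r" by (auto simp: altitude_def *)
  show "?r \<subseteq> ?l"
  proof
    fix w assume "w \<in> ?r"
    moreover obtain v where "w = to_complex v" using bij_is_surj[OF bij_to_complex] by blast
    ultimately show "w \<in> ?l" by (auto simp: altitude_def *)
  qed
qed

lemma collinear_to_complex_imp:
  assumes "collinear (to_complex ` T)"
  shows "collinear T"
proof -
  obtain u where u: "\<And>x y. x \<in> T \<Longrightarrow> y \<in> T \<Longrightarrow> \<exists>c. to_complex x - to_complex y = c *\<^sub>R u"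
    using assms unfolding collinear_def by blast
  obtain v where v: "u = to_complex v" using bij_is_surj[OF bij_to_complex] by blast
  have "\<exists>c. x - y = c *\<^sub>R v" if xy: "x \<in> T" "y \<in> T" for x y
  proof -
    obtain c where "to_complex x - to_complex y = c *\<^sub>R u" using u[OF xy] by blast
    then have "to_complex (x - y) = to_complex (c *\<^sub>R v)"
      by (simp add: v linear_diff[OF linear_to_complex] linear_scale[OF linear_to_complex])
    then show ?thesis using bij_is_inj[OF bij_to_complex] by (auto dest: injD)
  qed
  then show ?thesis unfolding collinear_def by blast
qed

lemma second_intersection_to_complex:
  assumes "second_intersection U V P X"
  shows "to_complex ` U \<inter> to_complex ` V = {to_complex P, to_complex X}"
  using assms image_Int[OF bij_is_inj[OF bij_to_complex], of U V]
  by (simp add: second_intersection_def)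

theorem theorem4p2:
  fixes A B C H J Q X Y Z L M N :: point
    and \<Sigma> S \<Gamma>A \<Gamma>B \<Gamma>C :: "point set"
  assumes "\<not> collinear {A, B, C}"
    and "circle_through \<Sigma> A B C"
    and "orthocentre H A B C"
    and "J \<in> \<Sigma>" "J \<noteq> A" "J \<noteq> B" "J \<noteq> C"
    and "Q \<in> perp_bisector J H"
    and "\<exists>r. S = sphere Q r" "J \<in> S" "H \<in> S"
    and "second_intersection (altitude A B C) S H X"
    and "second_intersection (altitude B C A) S H Y"
    and "second_intersection (altitude C A B) S H Z"
    and "\<not> collinear {A, J, X}" "\<not> collinear {B, J, Y}" "\<not> collinear {C, J, Z}"
    and "circle_through \<Gamma>A A J X"
    and "circle_through \<Gamma>B B J Y"
    and "circle_through \<Gamma>C C J Z"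
    and "second_intersection \<Gamma>B \<Gamma>C J L"
    and "second_intersection \<Gamma>C \<Gamma>A J M"
    and "second_intersection \<Gamma>A \<Gamma>B J N"
  shows "collinear {L, M, N}"
proof -
  let ?f = to_complex
  obtain E where E: "dist E A = dist E J" "dist E B = dist E J" "dist E C = dist E J"
    using assms(2,4) by (auto simp: circle_through_def)
  obtain r where r: "S = sphere Q r" using assms(9) by blast
  obtain PA ra where PA: "\<Gamma>A = sphere PA ra" "A \<in> \<Gamma>A" "J \<in> \<Gamma>A" "X \<in> \<Gamma>A"
    using assms(18) by (auto simp: circle_through_def)
  obtain PB rb where PB: "\<Gamma>B = sphere PB rb" "B \<in> \<Gamma>B" "J \<in> \<Gamma>B" "Y \<in> \<Gamma>B"
    using assms(19) by (auto simp: circle_through_def)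
  obtain PC rc where PC: "\<Gamma>C = sphere PC rc" "C \<in> \<Gamma>C" "J \<in> \<Gamma>C" "Z \<in> \<Gamma>C"
    using assms(20) by (auto simp: circle_through_def)
  have distinct: "A \<noteq> B" "B \<noteq> C" "C \<noteq> A"
    using assms(1) by (auto simp: insert_commute)
  have circ: "dist (?f E) (?f A) = dist (?f E) (?f J)" "dist (?f E) (?f B) = dist (?f E) (?f J)"
    "dist (?f E) (?f C) = dist (?f E) (?f J)"
    using E by (simp_all add: dist_to_complex)
  have inj: "?f U = ?f V \<longleftrightarrow> U = V" for U V
    using bij_is_inj[OF bij_to_complex] by (auto dest: injD)
  have ne: "?f A \<noteq> ?f B" "?f B \<noteq> ?f C" "?f C \<noteq> ?f A" "?f J \<noteq> ?f A" "?f J \<noteq> ?f B" "?f J \<noteq> ?f C"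
    using distinct assms(5-7) by (simp_all add: inj)
  have alt: "(?f H - ?f A) \<bullet> (?f C - ?f B) = 0" "(?f H - ?f B) \<bullet> (?f A - ?f C) = 0"
    "(?f H - ?f C) \<bullet> (?f B - ?f A) = 0"
    using assms(3) unfolding orthocentre_def altitude_def
    by (simp_all add: inner_to_complex flip: linear_diff[OF linear_to_complex])
  have eq: "dist (?f Q) (?f J) = dist (?f Q) (?f H)"
    using assms(10,11) by (simp add: r dist_to_complex)
  have nc: "\<not> collinear {?f U, ?f V, ?f W}" if "\<not> collinear {U, V, W}" for U V W
    using that collinear_to_complex_imp[of "{U, V, W}"] by auto
  have on: "?f U \<in> sphere (?f V) s" if "U \<in> sphere V s" for U V s
    using that by (simp add: dist_to_complex)
  note on_circles = PA(2-4)[unfolded PA(1), THEN on] PB(2-4)[unfolded PB(1), THEN on]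
    PC(2-4)[unfolded PC(1), THEN on]
  note second = assms(12-14,21-23)[THEN second_intersection_to_complex,
      unfolded r PA(1) PB(1) PC(1) image_sphere_to_complex image_altitude_to_complex]
  have "collinear {?f L, ?f M, ?f N}"
    by (rule collinear_second_intersections_complex[OF circ ne alt eq second(1-3)
        assms(15-17)[THEN nc] on_circles second(4-6)])
  then show ?thesis using collinear_to_complex_imp[of "{L, M, N}"] by simp
qed

end
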